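(* Let $\Omega\subseteq\mathbb{R}^N$ be Lebesgue measurable with $|\Omega|<\infty$, such that $\dim_B(\infty,\Omega)=D<-N$ and $0<\underline{\mathcal M}^D(\infty,\Omega)\le\overline{\mathcal M}^D(\infty,\Omega)<\infty$. If the tube zeta function $\widetilde\zeta_{\infty,\Omega}$ has a meromorphic continuation to a neighborhood of $s=D$, then $D$ is a simple pole and $$\underline{\mathcal M}^D(\infty,\Omega)\le\operatorname{res}(\widetilde\zeta_{\infty,\Omega},D)\le\overline{\mathcal M}^D(\infty,\Omega).$$ Moreover, if $\Omega$ is Minkowski measurable at infinity, then $$\operatorname{res}(\widetilde\zeta_{\infty,\Omega},D)=\mathcal M^D(\infty,\Omega).$$
   Context: $|\cdot|$ denotes $N$-dimensional Lebesgue measure. For $t>0$, ${}_t\Omega:=B_t(0)^c\cap\Omega$, where $B_t(0)$ is the open Euclidean ball of radius $t$ centered at $0$. For $r\in\mathbb{R}$, the upper and lower $r$-dimensional Minkowski contents of $\Omega$ at infinity, $\overline{\mathcal M}^r(\infty,\Omega)$ and $\underline{\mathcal M}^r(\infty,\Omega)$, are the $\limsup$ and $\liminf$ of $|{}_t\Omega|/t^{N+r}$ as $t\to+\infty$; if they coincide the common value is $\mathcal M^r(\infty,\Omega)$. The upper (lower) Minkowski dimension $\overline{\dim}_B(\infty,\Omega)$ ($\underline{\dim}_B(\infty,\Omega)$) is the infimum of all $r\in\mathbb{R}$ for which the upper (lower) $r$-dimensional content is $0$; if both coincide the common value is $\dim_B(\infty,\Omega)$. $\Omega$ is Minkowski measurable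 at infinity if for $D=\dim_B(\infty,\Omega)$ one has $0<\underline{\mathcal M}^D(\infty,\Omega)=\overline{\mathcal M}^D(\infty,\Omega)<\infty$. The tube zeta function at infinity is $\widetilde\zeta_{\infty,\Omega}(s)=\widetilde\zeta_{\infty,\Omega}(s;T):=\int_T^{+\infty}t^{-s-N-1}|{}_t\Omega|\,dt$ for a fixed $T>0$; it is holomorphic on $\{\operatorname{Re}s>\overline{\dim}_B(\infty,\Omega)\}$, and changing $T$ only adds an entire function. Meromorphic continuation means continuation from this half-plane; $\operatorname{res}(f,\omega)$ is the residue of $f$ at $\omega$. *)

theory Defs
  imports "HOL-Complex_Analysis.Complex_Analysis"
begin

definition tail_part :: "real \<Rightarrow> 'a::euclidean_space set \<Rightarrow> 'a set" where
  "tail_part t \<Omega> = - ball 0 t \<inter> \<Omega>"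

definition upper_content_inf :: "real \<Rightarrow> 'a::euclidean_space set \<Rightarrow> ereal" where
  "upper_content_inf r \<Omega> = Limsup at_top
     (\<lambda>t. enn2ereal (emeasure lebesgue (tail_part t \<Omega>)) / ereal (t powr (real DIM('a) + r)))"

definition lower_content_inf :: "real \<Rightarrow> 'a::euclidean_space set \<Rightarrow> ereal" where
  "lower_content_inf r \<Omega> = Liminf at_top
     (\<lambda>t. enn2ereal (emeasure lebesgue (tail_part t \<Omega>)) / ereal (t powr (real DIM('a) + r)))"

text \<open>
  The notions ``the content'' and ``the dimension'' exist only when the upper and the lower version
  coincide, so they are relations rather than functions.
\<close>

definition has_content_inf :: "real \<Rightarrow> 'a::euclidean_space set \<Rightarrow> ereal \<Rightarrow> bool" where
  "has_content_inf r \<Omega> m \<longleftrightarrow> lower_content_inf r \<Omega> = m \<and> upper_content_inf r \<Omega> = m"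

definition upper_dim_inf :: "'a::euclidean_space set \<Rightarrow> ereal" where
  "upper_dim_inf \<Omega> = (INF r\<in>{r. upper_content_inf r \<Omega> = 0}. ereal r)"

definition lower_dim_inf :: "'a::euclidean_space set \<Rightarrow> ereal" where
  "lower_dim_inf \<Omega> = (INF r\<in>{r. lower_content_inf r \<Omega> = 0}. ereal r)"

definition has_dim_inf :: "'a::euclidean_space set \<Rightarrow> ereal \<Rightarrow> bool" where
  "has_dim_inf \<Omega> d \<longleftrightarrow> lower_dim_inf \<Omega> = d \<and> upper_dim_inf \<Omega> = d"

definition minkowski_measurable_inf :: "'a::euclidean_space set \<Rightarrow> bool" where
  "minkowski_measurable_inf \<Omega> \<longleftrightarrow> (\<exists>D::real. has_dim_inf \<Omega> (ereal D) \<and>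
     0 < lower_content_inf D \<Omega> \<and> lower_content_inf D \<Omega> = upper_content_inf D \<Omega> \<and>
     upper_content_inf D \<Omega> < \<infinity>)"

text \<open>
  The real-valued \<^const>\<open>measure\<close> is used here because the integrand is complex; it is the Lebesgue
  measure of the tail whenever that is finite, in particular if \<open>\<Omega>\<close> has finite measure.
  Outside the domain of absolute convergence the value of the integral is the default \<open>0\<close>
  and carries no meaning.
\<close>

definition tube_zeta_inf :: "real \<Rightarrow> 'a::euclidean_space set \<Rightarrow> complex \<Rightarrow> complex" where
  "tube_zeta_inf T \<Omega> s = (LINT t:{T..}|lborel.
     complex_of_real t powr (- s - of_nat DIM('a) - 1) *
     complex_of_real (measure lebesgue (tail_part t \<Omega>)))"

text \<open>
  \<open>f\<close> is a meromorphic continuation of \<open>g\<close> from \<open>H\<close> to the domain \<open>U\<close>. The values of \<open>f\<close> at its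
  poles are irrelevant, as usual for \<open>meromorphic_on\<close>.
\<close>

definition meromorphic_continuation ::
    "(complex \<Rightarrow> complex) \<Rightarrow> complex set \<Rightarrow> (complex \<Rightarrow> complex) \<Rightarrow> complex set \<Rightarrow> bool" where
  "meromorphic_continuation g H f U \<longleftrightarrow>
     open U \<and> connected U \<and> H \<subseteq> U \<and> f meromorphic_on U \<and> (\<forall>s\<in>H. f s = g s)"

definition simple_pole :: "(complex \<Rightarrow> complex) \<Rightarrow> complex \<Rightarrow> bool" where
  "simple_pole f z \<longleftrightarrow> isolated_singularity_at f z \<and> is_pole f z \<and> zorder f z = -1"

end

theory Submission
  imports Defs
begin

text \<open>
  Let \<open>V t\<close> be the volume of the part of \<open>\<Omega>\<close> outside the ball of radius \<open>t\<close>. The two Minkowski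
  contents at infinity are the lower and upper limits of \<open>V t / t powr b\<close>, where \<open>b\<close> is the
  dimension of the space plus \<open>D\<close>, and for \<open>p > 0\<close> the tube zeta function at \<open>D + p\<close> is the real
  integral of \<open>t powr (- p - b - 1) * V t\<close> over \<open>{T..}\<close>. If \<open>V t\<close> were exactly \<open>u * t powr b\<close>, then
  \<open>p\<close> times this integral would be \<open>u * T powr (- p)\<close>, which tends to \<open>u\<close> as \<open>p\<close> tends to \<open>0\<close>
  from the right. Comparing \<open>V\<close> with such powers from above and below
  (\<open>abelian_upper_bound\<close> and \<open>abelian_lower_bound\<close>) shows that every limit point of
  \<open>p\<close> times the zeta function at \<open>D + p\<close> lies between the lower and the upper content.

  On the complex side, let \<open>f\<close> be the meromorphic continuation and \<open>g w = f w * (w - D)\<close>. Along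
  the ray to the right of \<open>D\<close> the function \<open>g\<close> is real, bounded, and bounded away from \<open>0\<close>,
  because the contents are finite and positive. A meromorphic function that stays bounded on some
  approach to a point has no pole there, so \<open>g\<close> has a limit at \<open>D\<close>, and the ray shows that this
  limit is real and nonzero. Hence \<open>f\<close> has a simple pole at \<open>D\<close> and the limit is its residue
  (\<open>simple_pole_residue_along\<close>). Since it is also the limit along the ray, the Abelian bounds
  place it between the contents; when these agree, it is their common value.
\<close>

section \<open>Integrals of power-like functions over a half-line\<close>

lemma powr_tail_integral:
  fixes a T :: real
  assumes "a > 0" "T > 0"
  shows set_integrable_powr_tail: "set_integrable lborel {T..} (\<lambda>t. t powr (- a - 1))"
    and set_integral_powr_tail: "(LINT t:{T..}|lborel. t powr (- a - 1)) = T powr (- a) / a"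
proof -
  have hk: "((\<lambda>t. t powr (- a - 1)) has_integral T powr (- a) / a) {T..}"
    using has_integral_powr_to_inf[of "- a - 1" T] assms by simp
  have "(\<lambda>t. t powr (- a - 1)) absolutely_integrable_on {T..}"
    using hk by (intro nonnegative_absolutely_integrable_1) (auto simp: integrable_on_def)
  then show si: "set_integrable lborel {T..} (\<lambda>t. t powr (- a - 1))"
    unfolding set_integrable_def by (subst (asm) integrable_completion) auto
  show "(LINT t:{T..}|lborel. t powr (- a - 1)) = T powr (- a) / a"
    using set_borel_integral_eq_integral(2)[OF si] integral_unique[OF hk] by simp
qed

text \<open>
  The exponent is shifted by the growth rate \<open>b\<close>, so that the integral is dominated by that of a
  multiple of \<open>t powr (- p - 1)\<close>, whatever \<open>b\<close> is, and the critical point is \<open>p = 0\<close>.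
\<close>

lemma set_integrable_power_growth:
  fixes W :: "real \<Rightarrow> real" and b p B T :: real
  assumes "p > 0" "T > 0" and [measurable]: "W \<in> borel_measurable borel"
    and bound: "\<And>t. t \<ge> T \<Longrightarrow> \<bar>W t\<bar> \<le> B * t powr b"
  shows "set_integrable lborel {T..} (\<lambda>t. t powr (- p - b - 1) * W t)"
proof (rule set_integrable_bound)
  show "set_integrable lborel {T..} (\<lambda>t. B * t powr (- p - 1))"
    using set_integrable_powr_tail[OF assms(1,2)] by simp
  show "set_borel_measurable lborel {T..} (\<lambda>t. t powr (- p - b - 1) * W t)"
    unfolding set_borel_measurable_def by measurable
  have "norm (t powr (- p - b - 1) * W t) \<le> norm (B * t powr (- p - 1))" if "t \<ge> T" for t
  proof -
    have "norm (t powr (- p - b - 1) * W t) = t powr (- p - b - 1) * \<bar>W t\<bar>"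
      by (simp add: abs_mult)
    also have "\<dots> \<le> t powr (- p - b - 1) * (B * t powr b)"
      using bound[OF that] by (intro mult_left_mono) auto
    also have "\<dots> = B * t powr (- p - 1)"
      using powr_add[of t "- p - b - 1" b] by simp
    also have "\<dots> \<le> norm (B * t powr (- p - 1))" by simp
    finally show ?thesis .
  qed
  then show "AE t in lborel. t \<in> {T..} \<longrightarrow>
      norm (t powr (- p - b - 1) * W t) \<le> norm (B * t powr (- p - 1))"
    by auto
qed

text \<open>
  On the compact range where the eventual bound may fail, everything in sight is bounded and
  \<open>t powr c\<close> is bounded away from \<open>0\<close>, so a large multiple of it absorbs the excess. With the
  bound valid on all of \<open>{T..}\<close>, integrals can be compared without splitting the range. The exponent
  \<open>c\<close> is at the caller's disposal: \<open>c = b\<close> gives a plain bound of order \<open>t powr b\<close>, and \<open>c < b\<close>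
  keeps the leading coefficient \<open>u\<close>.
\<close>

lemma eventual_power_bound_extends:
  fixes W k :: "real \<Rightarrow> real" and b c u T :: real
  assumes "T > 0" and k: "continuous_on {T..} k" "\<And>t. t \<ge> T \<Longrightarrow> W t \<le> k t"
    and ev: "\<forall>\<^sub>F t in at_top. W t \<le> u * t powr b"
  obtains C where "C \<ge> 0" "\<And>t. t \<ge> T \<Longrightarrow> W t \<le> u * t powr b + C * t powr c"
proof -
  obtain t0 where t0: "\<And>t. t \<ge> t0 \<Longrightarrow> W t \<le> u * t powr b"
    using ev unfolding eventually_at_top_linorder by blast
  define h where "h = (\<lambda>t. (k t - u * t powr b) / t powr c)"
  have "continuous_on {T..t0} h"
    unfolding h_def using \<open>T > 0\<close>
    by (intro continuous_intros continuous_on_subset[OF k(1)]) auto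
  then have "bounded (h ` {T..t0})"
    by (intro compact_imp_bounded compact_continuous_image) auto
  then obtain C where C: "\<And>t. t \<in> {T..t0} \<Longrightarrow> \<bar>h t\<bar> \<le> C"
    unfolding bounded_iff by (metis real_norm_def image_eqI)
  show thesis
  proof (rule that[of "max C 0"])
    fix t assume t: "t \<ge> T"
    show "W t \<le> u * t powr b + max C 0 * t powr c"
    proof (cases "t \<le> t0")
      case True
      have pos: "t powr c > 0" using t \<open>T > 0\<close> by simp
      have "h t \<le> max C 0" using C[of t] t True by auto
      then have "k t - u * t powr b \<le> max C 0 * t powr c"
        using pos unfolding h_def by (simp add: pos_divide_le_eq)
      then show ?thesis using k(2)[OF t] by linarith
    next
      case False
      then have "W t \<le> u * t powr b" using t0 by simp
      moreover have "0 \<le> max C 0 * t powr c" by simp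
      ultimately show ?thesis by linarith
    qed
  qed simp
qed

section \<open>An Abelian theorem for truncated Mellin transforms\<close>

text \<open>
  Integrating the comparison function \<open>u * t powr b + C * t powr (b - 1)\<close> against
  \<open>t powr (- p - b - 1)\<close> gives two explicit terms. Only the first has a pole at \<open>p = 0\<close>; after
  multiplication by \<open>p\<close> it tends to \<open>u\<close>, and the correction, hence \<open>C\<close>, disappears.
\<close>

lemma abelian_upper_bound:
  fixes W :: "real \<Rightarrow> real" and b u u' B T :: real
  assumes "T > 0" and W: "W \<in> borel_measurable borel"
    and B: "\<And>t. t \<ge> T \<Longrightarrow> \<bar>W t\<bar> \<le> B * t powr b"
    and ev: "\<forall>\<^sub>F t in at_top. W t \<le> u * t powr b" and "u < u'"
  shows "\<forall>\<^sub>F p in at_right 0. p * (LINT t:{T..}|lborel. t powr (- p - b - 1) * W t) < u'"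
proof -
  have "continuous_on {T..} (\<lambda>t. B * t powr b)"
    using \<open>T > 0\<close> by (intro continuous_intros) auto
  moreover have "W t \<le> B * t powr b" if "t \<ge> T" for t
    using B[OF that] by simp
  ultimately obtain C where C: "\<And>t. t \<ge> T \<Longrightarrow> W t \<le> u * t powr b + C * t powr (b - 1)"
    using eventual_power_bound_extends[OF \<open>T > 0\<close> _ _ ev] by metis
  define R where "R = (\<lambda>p. u * T powr (- p) + p * (C * (T powr (- p - 1) / (p + 1))))"
  have le: "p * (LINT t:{T..}|lborel. t powr (- p - b - 1) * W t) \<le> R p" if "p > 0" for p
  proof -
    note i1 = set_integrable_powr_tail[OF \<open>p > 0\<close> \<open>T > 0\<close>]
    have "- (p + 1) = - p - 1" by simp
    then have i2: "set_integrable lborel {T..} (\<lambda>t. t powr (- p - 1 - 1))"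
      and v2: "(LINT t:{T..}|lborel. t powr (- p - 1 - 1)) = T powr (- p - 1) / (p + 1)"
      using powr_tail_integral[of "p + 1" T] that \<open>T > 0\<close> by simp_all
    have "(LINT t:{T..}|lborel. t powr (- p - b - 1) * W t)
        \<le> (LINT t:{T..}|lborel. u * t powr (- p - 1) + C * t powr (- p - 1 - 1))"
    proof (rule set_integral_mono)
      show "set_integrable lborel {T..} (\<lambda>t. t powr (- p - b - 1) * W t)"
        by (rule set_integrable_power_growth[OF that \<open>T > 0\<close> W B])
      show "set_integrable lborel {T..} (\<lambda>t. u * t powr (- p - 1) + C * t powr (- p - 1 - 1))"
        using i1 i2 by (intro set_integral_add) auto
      have exps: "- p - b - 1 + b = - p - 1" "- p - b - 1 + (b - 1) = - p - 1 - 1"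
        by simp_all
      fix t assume "t \<in> {T..}"
      then have "t powr (- p - b - 1) * W t
          \<le> t powr (- p - b - 1) * (u * t powr b + C * t powr (b - 1))"
        using C by (intro mult_left_mono) auto
      also have "\<dots> = u * t powr (- p - 1) + C * t powr (- p - 1 - 1)"
        unfolding distrib_left mult.left_commute[of "t powr (- p - b - 1)"] powr_add[symmetric]
        by (simp only: exps)
      finally show "t powr (- p - b - 1) * W t
          \<le> u * t powr (- p - 1) + C * t powr (- p - 1 - 1)" .
    qed
    also have "\<dots> = u * (T powr (- p) / p) + C * (T powr (- p - 1) / (p + 1))"
      using i1 i2 set_integral_powr_tail[OF \<open>p > 0\<close> \<open>T > 0\<close>] v2
      by (subst set_integral_add) simp_all
    finally have "p * (LINT t:{T..}|lborel. t powr (- p - b - 1) * W t)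
        \<le> p * (u * (T powr (- p) / p) + C * (T powr (- p - 1) / (p + 1)))"
      using that by (intro mult_left_mono) auto
    also have "\<dots> = R p"
      using that unfolding R_def by (simp add: distrib_left)
    finally show ?thesis .
  qed
  have "(R \<longlongrightarrow> u * T powr (- 0) + 0 * (C * (T powr (- 0 - 1) / (0 + 1)))) (at_right 0)"
    unfolding R_def using \<open>T > 0\<close> by (intro tendsto_intros) auto
  then have "(R \<longlongrightarrow> u) (at_right 0)"
    using \<open>T > 0\<close> by simp
  then have "\<forall>\<^sub>F p in at_right 0. R p < u'"
    using \<open>u < u'\<close> by (rule order_tendstoD)
  then show ?thesis
    using eventually_at_right_less[of "0::real"] by eventually_elim (use le in force)
qed

lemma abelian_lower_bound:
  fixes W :: "real \<Rightarrow> real" and b l l' B T :: real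
  assumes "T > 0" and W: "W \<in> borel_measurable borel"
    and B: "\<And>t. t \<ge> T \<Longrightarrow> \<bar>W t\<bar> \<le> B * t powr b"
    and ev: "\<forall>\<^sub>F t in at_top. l * t powr b \<le> W t" and "l' < l"
  shows "\<forall>\<^sub>F p in at_right 0. l' < p * (LINT t:{T..}|lborel. t powr (- p - b - 1) * W t)"
proof -
  have "\<forall>\<^sub>F p in at_right 0. p * (LINT t:{T..}|lborel. t powr (- p - b - 1) * - W t) < - l'"
    using W B ev \<open>l' < l\<close>
    by (intro abelian_upper_bound[OF \<open>T > 0\<close>, where u = "- l" and B = B]) auto
  then show ?thesis
    unfolding mult_minus_right set_lebesgue_integral_def scaleR_minus_right integral_minus by simp
qed

section \<open>Poles of order one from a bound along a filter\<close>

lemma meromorphic_bounded_along_has_limit: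
  assumes "g meromorphic_on {z}" and F: "F \<le> at z" "F \<noteq> bot"
    and bdd: "\<forall>\<^sub>F w in F. norm (g w) \<le> B"
  obtains c where "(g \<longlongrightarrow> c) (at z)"
proof -
  have "\<not> is_pole g z"
  proof
    assume "is_pole g z"
    then have "filterlim g at_infinity F"
      unfolding is_pole_def by (rule filterlim_mono[OF _ order_refl F(1)])
    then have "\<forall>\<^sub>F w in F. norm (g w) \<ge> B + 1 "
      unfolding filterlim_at_infinity_conv_norm_at_top filterlim_at_top by blast
    with bdd have "\<forall>\<^sub>F w in F. False" by eventually_elim linarith
    then show False using F(2) by simp
  qed
  then show thesis
    using meromorphic_on_not_essential[OF assms(1)] that unfolding not_essential_def by blast
qed

text \<open>
  Filling the removable singularity of \<open>f w * (w - z)\<close> with the value \<open>c\<close> exhibits \<open>f\<close> as a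
  nonvanishing holomorphic function over \<open>w - z\<close>, which gives the order of the pole.
\<close>

lemma simple_pole_if_limit:
  assumes f: "f meromorphic_on {z}" and lim: "((\<lambda>w. f w * (w - z)) \<longlongrightarrow> c) (at z)" and "c \<noteq> 0"
  shows "simple_pole f z" "residue f z = c"
proof -
  have iso: "isolated_singularity_at f z"
    using meromorphic_on_isolated_singularity[OF f] .
  then obtain r where r: "r > 0" "f analytic_on ball z r - {z}"
    unfolding isolated_singularity_at_def by blast
  then have holo: "f holomorphic_on ball z r - {z}"
    by (simp add: analytic_imp_holomorphic)
  show "residue f z = c"
    using residue_simple'[OF open_ball _ holo lim] r by simp
  define g where "g = (\<lambda>w. if w = z then c else f w * (w - z))"
  have "(\<lambda>w. f w * (w - z)) holomorphic_on ball z r - {z}"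
    using holo by (intro holomorphic_intros)
  then have "g holomorphic_on ball z r - {z}"
    by (rule holomorphic_transform) (auto simp: g_def)
  moreover
  have "(g \<longlongrightarrow> g z) (at z)"
    by (rule tendsto_eq_rhs[OF Lim_transform_eventually[OF lim]])
       (auto simp: g_def eventually_at intro!: exI[of _ 1])
  then have "(g \<longlongrightarrow> g z) (at z within ball z r)"
    by (rule tendsto_mono[OF at_le, rotated]) simp
  ultimately have gh: "g holomorphic_on ball z r"
    by (metis no_isolated_singularity' open_ball finite.emptyI finite.insertI singletonD)
  have z: "zorder f z = - 1"
    by (rule zorder_eqI[OF open_ball _ gh])
       (use r \<open>c \<noteq> 0\<close> in \<open>auto simp: g_def power_int_minus field_simps\<close>)
  have "filterlim (\<lambda>w. w - z) (at 0) (at z)"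
    by (auto simp: filterlim_at eventually_at intro!: exI[of _ 1] tendsto_eq_intros)
  then have "is_pole (\<lambda>w. (f w * (w - z)) / (w - z)) z"
    unfolding is_pole_def using lim \<open>c \<noteq> 0\<close> by (intro filterlim_divide_at_infinity)
  then have "is_pole f z"
    by (rule is_pole_cong[THEN iffD1, rotated 2]) (auto simp: eventually_at intro!: exI[of _ 1])
  with iso z show "simple_pole f z" by (simp add: simple_pole_def)
qed

text \<open>
  Meromorphy is what turns information on one ray into a limit from all directions: an essential
  singularity could be bounded on a ray without having a limit. The lower bound \<open>l > 0\<close> excludes
  that \<open>f\<close> is regular at \<open>D\<close>.
\<close>

lemma simple_pole_residue_along:
  fixes f :: "complex \<Rightarrow> complex" and \<phi> :: "real \<Rightarrow> real" and D l u :: real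
  assumes f: "f meromorphic_on {complex_of_real D}" and "0 < l"
    and eq: "\<forall>\<^sub>F p in at_right 0. f (complex_of_real (D + p)) * complex_of_real p = complex_of_real (\<phi> p)"
    and lu: "\<forall>\<^sub>F p in at_right 0. \<phi> p \<in> {l..u}"
  shows "simple_pole f (complex_of_real D)" "residue f (complex_of_real D) \<in> \<real>"
    "(\<phi> \<longlongrightarrow> Re (residue f (complex_of_real D))) (at_right 0)"
proof -
  define F where "F = filtermap (\<lambda>p. complex_of_real (D + p)) (at_right 0)"
  define g where "g = (\<lambda>w. f w * (w - complex_of_real D))"
  have "filterlim (\<lambda>p. complex_of_real (D + p)) (at (complex_of_real D)) (at_right 0)"
    unfolding filterlim_at
  proof
    show "\<forall>\<^sub>F p in at_right 0. complex_of_real (D + p) \<in> UNIV \<and>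
        complex_of_real (D + p) \<noteq> complex_of_real D"
      using eventually_at_right_less[of "0::real"] by eventually_elim auto
    have "((\<lambda>p. complex_of_real (D + p)) \<longlongrightarrow> complex_of_real (D + 0)) (at_right 0)"
      by (intro tendsto_intros)
    then show "((\<lambda>p. complex_of_real (D + p)) \<longlongrightarrow> complex_of_real D) (at_right 0)"
      by simp
  qed
  then have F: "F \<le> at (complex_of_real D)" by (simp add: F_def filterlim_def)
  have Fnb: "F \<noteq> bot"
    by (simp add: F_def filtermap_bot_iff trivial_limit_at_right_real)
  have g: "g meromorphic_on {complex_of_real D}"
    unfolding g_def using f by (intro meromorphic_intros)
  have geq: "\<forall>\<^sub>F p in at_right 0. g (complex_of_real (D + p)) = complex_of_real (\<phi> p)"
    using eq by eventually_elim (simp add: g_def)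
  have "\<forall>\<^sub>F w in F. norm (g w) \<le> u"
    unfolding F_def eventually_filtermap using geq lu
    by eventually_elim (use \<open>0 < l\<close> in auto)
  then obtain c where c: "(g \<longlongrightarrow> c) (at (complex_of_real D))"
    using meromorphic_bounded_along_has_limit[OF g F Fnb] by metis
  have "((\<lambda>p. g (complex_of_real (D + p))) \<longlongrightarrow> c) (at_right 0)"
    using tendsto_mono[OF F c] by (simp add: F_def filterlim_filtermap)
  then have \<phi>c: "((\<lambda>p. complex_of_real (\<phi> p)) \<longlongrightarrow> c) (at_right 0)"
    by (rule Lim_transform_eventually[OF _ geq])
  have Re: "(\<phi> \<longlongrightarrow> Re c) (at_right 0)" using tendsto_Re[OF \<phi>c] by simp
  have "((\<lambda>p. 0::real) \<longlongrightarrow> Im c) (at_right (0::real))" using tendsto_Im[OF \<phi>c] by simp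
  then have Im: "Im c = 0" by (simp add: tendsto_const_iff)
  have "l \<le> Re c"
    by (rule tendsto_lowerbound[OF Re]) (use lu in \<open>auto elim: eventually_mono\<close>)
  then have "c \<noteq> 0" using \<open>0 < l\<close> by auto
  note sp = simple_pole_if_limit[OF f c[unfolded g_def] this]
  show "simple_pole f (complex_of_real D)" by (rule sp)
  show "residue f (complex_of_real D) \<in> \<real>" using Im by (simp add: sp(2) complex_is_Real_iff)
  show "(\<phi> \<longlongrightarrow> Re (residue f (complex_of_real D))) (at_right 0)" using Re by (simp add: sp(2))
qed

section \<open>The tail volume and its Mellin transform\<close>

lemma tail_part_fmeasurable:
  assumes "\<Omega> \<in> sets lebesgue" "emeasure lebesgue \<Omega> < \<infinity>"
  shows "tail_part t \<Omega> \<in> fmeasurable lebesgue"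
  unfolding tail_part_def Int_commute[of _ \<Omega>]
  by (rule fmeasurable_Int_fmeasurable) (use assms in \<open>auto intro: fmeasurableI\<close>)

lemma tail_volume_antimono:
  assumes "\<Omega> \<in> sets lebesgue" "emeasure lebesgue \<Omega> < \<infinity>" "t \<le> t'"
  shows "measure lebesgue (tail_part t' \<Omega>) \<le> measure lebesgue (tail_part t \<Omega>)"
  by (rule measure_mono_fmeasurable)
     (use assms(3) tail_part_fmeasurable[OF assms(1,2)] in
       \<open>auto simp: tail_part_def fmeasurableD\<close>)

lemma tail_volume_measurable:
  assumes "\<Omega> \<in> sets lebesgue" "emeasure lebesgue \<Omega> < \<infinity>"
  shows "(\<lambda>t. measure lebesgue (tail_part t \<Omega>)) \<in> borel_measurable borel"
proof -
  have "mono (\<lambda>t. - measure lebesgue (tail_part t \<Omega>))"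
    using tail_volume_antimono[OF assms] by (auto intro: monoI)
  then have "(\<lambda>t. - measure lebesgue (tail_part t \<Omega>)) \<in> borel_measurable borel"
    by (rule borel_measurable_mono)
  then show ?thesis by simp
qed

lemma tail_volume_ratio:
  assumes "\<Omega> \<in> sets lebesgue" "emeasure lebesgue \<Omega> < \<infinity>" "x > 0"
  shows "enn2ereal (emeasure lebesgue (tail_part t \<Omega>)) / ereal x
    = ereal (measure lebesgue (tail_part t \<Omega>) / x)"
proof -
  have "emeasure lebesgue (tail_part t \<Omega>) = ennreal (measure lebesgue (tail_part t \<Omega>))"
    using fmeasurableD2[OF tail_part_fmeasurable[OF assms(1,2)]]
    by (rule emeasure_eq_ennreal_measure)
  then show ?thesis
    using \<open>x > 0\<close> by (simp only: enn2ereal_ennreal measure_nonneg ereal_divide) simp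
qed

text \<open>
  The next two lemmas trade the extended-real contents for real inequalities, in the form that the
  Abelian theorem needs.
\<close>

lemma eventually_tail_volume_le:
  fixes \<Omega> :: "'a::euclidean_space set"
  assumes "\<Omega> \<in> sets lebesgue" "emeasure lebesgue \<Omega> < \<infinity>"
    and "upper_content_inf r \<Omega> < ereal u"
  shows "\<forall>\<^sub>F t in at_top. measure lebesgue (tail_part t \<Omega>) \<le> u * t powr (real DIM('a) + r)"
  using Limsup_lessD[OF assms(3)[unfolded upper_content_inf_def]] eventually_gt_at_top[of 0]
proof eventually_elim
  case (elim t)
  then have x: "t powr (real DIM('a) + r) > 0" by simp
  show ?case
    using elim(1) x unfolding tail_volume_ratio[OF assms(1,2) x] by (simp add: pos_divide_less_eq)
qed

lemma eventually_tail_volume_ge: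
  fixes \<Omega> :: "'a::euclidean_space set"
  assumes "\<Omega> \<in> sets lebesgue" "emeasure lebesgue \<Omega> < \<infinity>"
    and "ereal l < lower_content_inf r \<Omega>"
  shows "\<forall>\<^sub>F t in at_top. l * t powr (real DIM('a) + r) \<le> measure lebesgue (tail_part t \<Omega>)"
  using less_LiminfD[OF assms(3)[unfolded lower_content_inf_def]] eventually_gt_at_top[of 0]
proof eventually_elim
  case (elim t)
  then have x: "t powr (real DIM('a) + r) > 0" by simp
  show ?case
    using elim(1) x unfolding tail_volume_ratio[OF assms(1,2) x] by (simp add: pos_less_divide_eq)
qed

lemma tube_zeta_inf_of_real:
  fixes \<Omega> :: "'a::euclidean_space set"
  assumes "T > 0"
  shows "tube_zeta_inf T \<Omega> (complex_of_real s) = complex_of_real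
    (LINT t:{T..}|lborel. t powr (- s - real DIM('a) - 1) * measure lebesgue (tail_part t \<Omega>))"
proof -
  have "complex_of_real t powr (- complex_of_real s - of_nat DIM('a) - 1)
      = complex_of_real (t powr (- s - real DIM('a) - 1))" if "t \<ge> T" for t
    using that assms powr_of_real[of t "- s - real DIM('a) - 1"] by simp
  then show ?thesis
    unfolding tube_zeta_inf_def set_integral_complex_of_real[symmetric]
    by (intro set_lebesgue_integral_cong) auto
qed

lemma tail_volume_mellin_bounds:
  fixes \<Omega> :: "'a::euclidean_space set" and D T :: real
  assumes \<Omega>: "\<Omega> \<in> sets lebesgue" "emeasure lebesgue \<Omega> < \<infinity>"
    and fin: "upper_content_inf D \<Omega> < \<infinity>" and "T > 0"
  defines "\<phi> \<equiv> \<lambda>p. p * (LINT t:{T..}|lborel.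
      t powr (- p - (real DIM('a) + D) - 1) * measure lebesgue (tail_part t \<Omega>))"
  shows "ereal l < lower_content_inf D \<Omega> \<Longrightarrow> \<forall>\<^sub>F p in at_right 0. l < \<phi> p"
    and "upper_content_inf D \<Omega> < ereal u \<Longrightarrow> \<forall>\<^sub>F p in at_right 0. \<phi> p < u"
proof -
  define V where "V = (\<lambda>t. measure lebesgue (tail_part t \<Omega>))"
  define b where "b = real DIM('a) + D"
  have meas: "V \<in> borel_measurable borel"
    unfolding V_def by (rule tail_volume_measurable[OF \<Omega>])
  have V0: "0 \<le> V t" for t by (simp add: V_def)
  have K: "V t \<le> V T" if "t \<ge> T" for t
    unfolding V_def by (rule tail_volume_antimono[OF \<Omega> that])
  (* Any finite number above the upper content gives the order of growth that makes the
     integrals converge; its size does not enter the limit. *)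
  obtain u0 where "upper_content_inf D \<Omega> < ereal u0"
    using ereal_dense2[OF fin] by blast
  then have "\<forall>\<^sub>F t in at_top. V t \<le> u0 * t powr b"
    unfolding V_def b_def by (rule eventually_tail_volume_le[OF \<Omega>])
  then obtain C where "\<And>t. t \<ge> T \<Longrightarrow> V t \<le> u0 * t powr b + C * t powr b"
    using eventual_power_bound_extends[where W = V, OF \<open>T > 0\<close> continuous_on_const K] by blast
  then have B: "\<bar>V t\<bar> \<le> (u0 + C) * t powr b" if "t \<ge> T" for t
    using that V0[of t] by (simp add: distrib_right)
  show "\<forall>\<^sub>F p in at_right 0. l < \<phi> p" if l: "ereal l < lower_content_inf D \<Omega>"
  proof -
    (* The Abelian bounds lose an arbitrarily small amount, hence the intermediate constant. *)
    obtain l1 where "ereal l < ereal l1" "ereal l1 < lower_content_inf D \<Omega>"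
      using ereal_dense2[OF l] by blast
    then have ev: "\<forall>\<^sub>F t in at_top. l1 * t powr b \<le> V t" "l < l1"
      unfolding V_def b_def by (auto intro: eventually_tail_volume_ge[OF \<Omega>])
    have "\<forall>\<^sub>F p in at_right 0. l < p * (LINT t:{T..}|lborel. t powr (- p - b - 1) * V t)"
      by (rule abelian_lower_bound[OF \<open>T > 0\<close> meas _ ev]) (rule B)
    then show ?thesis unfolding \<phi>_def b_def V_def .
  qed
  show "\<forall>\<^sub>F p in at_right 0. \<phi> p < u" if u: "upper_content_inf D \<Omega> < ereal u"
  proof -
    obtain u1 where "upper_content_inf D \<Omega> < ereal u1" "ereal u1 < ereal u"
      using ereal_dense2[OF u] by blast
    then have ev: "\<forall>\<^sub>F t in at_top. V t \<le> u1 * t powr b" "u1 < u"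
      unfolding V_def b_def by (auto intro: eventually_tail_volume_le[OF \<Omega>])
    have "\<forall>\<^sub>F p in at_right 0. p * (LINT t:{T..}|lborel. t powr (- p - b - 1) * V t) < u"
      by (rule abelian_upper_bound[OF \<open>T > 0\<close> meas _ ev]) (rule B)
    then show ?thesis unfolding \<phi>_def b_def V_def .
  qed
qed

section \<open>Residue and Minkowski content\<close>

theorem theorem3p3:
  fixes \<Omega> :: "(real ^ 'n) set" and D T :: real
    and f :: "complex \<Rightarrow> complex" and U :: "complex set"
  assumes "\<Omega> \<in> sets lebesgue" and "emeasure lebesgue \<Omega> < \<infinity>"
    and "has_dim_inf \<Omega> (ereal D)" and "D < - real CARD('n)"
    and "0 < lower_content_inf D \<Omega>"
    and "lower_content_inf D \<Omega> \<le> upper_content_inf D \<Omega>"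
    and "upper_content_inf D \<Omega> < \<infinity>"
    and "T > 0"
    and "meromorphic_continuation (tube_zeta_inf T \<Omega>) {s. upper_dim_inf \<Omega> < ereal (Re s)} f U"
    and "complex_of_real D \<in> U"
  shows "simple_pole f (complex_of_real D)
    \<and> residue f (complex_of_real D) \<in> \<real>
    \<and> lower_content_inf D \<Omega> \<le> ereal (Re (residue f (complex_of_real D)))
    \<and> ereal (Re (residue f (complex_of_real D))) \<le> upper_content_inf D \<Omega>
    \<and> (minkowski_measurable_inf \<Omega> \<longrightarrow>
         has_content_inf D \<Omega> (ereal (Re (residue f (complex_of_real D)))))"
proof -
  note \<Omega> = assms(1,2)
  define \<phi> where "\<phi> = (\<lambda>p. p * (LINT t:{T..}|lborel.
      t powr (- p - (real DIM(real ^ 'n) + D) - 1) * measure lebesgue (tail_part t \<Omega>)))"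
  have bounds:
    "\<And>l. ereal l < lower_content_inf D \<Omega> \<Longrightarrow> \<forall>\<^sub>F p in at_right 0. l < \<phi> p"
    "\<And>u. upper_content_inf D \<Omega> < ereal u \<Longrightarrow> \<forall>\<^sub>F p in at_right 0. \<phi> p < u"
    unfolding \<phi>_def by (rule tail_volume_mellin_bounds[OF \<Omega> assms(7,8)]; assumption)+
  have f: "f meromorphic_on {complex_of_real D}"
    using assms(9,10) unfolding meromorphic_continuation_def
    by (auto intro: meromorphic_on_subset)
  have eq: "f (complex_of_real (D + p)) * complex_of_real p = complex_of_real (\<phi> p)" if "p > 0" for p
  proof -
    have "upper_dim_inf \<Omega> < ereal (Re (complex_of_real (D + p)))"
      using assms(3) that by (simp add: has_dim_inf_def)
    then have "f (complex_of_real (D + p)) = tube_zeta_inf T \<Omega> (complex_of_real (D + p))"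
      using assms(9) unfolding meromorphic_continuation_def by blast
    moreover have "- (D + p) - real DIM(real ^ 'n) - 1 = - p - (real DIM(real ^ 'n) + D) - 1"
      by simp
    ultimately show ?thesis
      unfolding tube_zeta_inf_of_real[OF \<open>T > 0\<close>] \<phi>_def by (simp only: of_real_mult mult.commute)
  qed
  then have eq_ev: "\<forall>\<^sub>F p in at_right 0.
      f (complex_of_real (D + p)) * complex_of_real p = complex_of_real (\<phi> p)"
    using eventually_at_right_less[of "0::real"] by (rule eventually_mono[rotated])
  obtain l where l: "0 < l" "ereal l < lower_content_inf D \<Omega>"
    using ereal_dense2[OF assms(5)] by auto
  obtain u where u: "upper_content_inf D \<Omega> < ereal u"
    using ereal_dense2[OF assms(7)] by blast
  have lu: "\<forall>\<^sub>F p in at_right 0. \<phi> p \<in> {l..u}"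
    using bounds(1)[OF l(2)] bounds(2)[OF u] by eventually_elim simp
  note res = simple_pole_residue_along[OF f l(1) eq_ev lu]
  define c where "c = Re (residue f (complex_of_real D))"
  have lim: "(\<phi> \<longlongrightarrow> c) (at_right 0)"
    unfolding c_def by (rule res)
  have lower: "lower_content_inf D \<Omega> \<le> ereal c"
  proof (rule ccontr)
    assume "\<not> ?thesis"
    then obtain x where x: "ereal c < ereal x" "ereal x < lower_content_inf D \<Omega>"
      using ereal_dense2[of "ereal c"] by (meson not_le)
    have "x \<le> c"
      by (rule tendsto_lowerbound[OF lim])
         (use bounds(1)[OF x(2)] in \<open>auto elim: eventually_mono\<close>)
    with x(1) show False by simp
  qed
  have upper: "ereal c \<le> upper_content_inf D \<Omega>"
  proof (rule ccontr)
    assume "\<not> ?thesis"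
    then obtain x where x: "upper_content_inf D \<Omega> < ereal x" "ereal x < ereal c"
      using ereal_dense2[of _ "ereal c"] by (meson not_le)
    have "c \<le> x"
      by (rule tendsto_upperbound[OF lim])
         (use bounds(2)[OF x(1)] in \<open>auto elim: eventually_mono\<close>)
    with x(2) show False by simp
  qed
  have "has_content_inf D \<Omega> (ereal c)" if "minkowski_measurable_inf \<Omega>"
  proof -
    obtain D' where "has_dim_inf \<Omega> (ereal D')"
      and eq': "lower_content_inf D' \<Omega> = upper_content_inf D' \<Omega>"
      using \<open>minkowski_measurable_inf \<Omega>\<close> unfolding minkowski_measurable_inf_def by blast
    then have "D' = D" using assms(3) by (simp add: has_dim_inf_def)
    then show ?thesis using eq' lower upper by (simp add: has_content_inf_def)
  qed
  then show ?thesis using res(1,2) lower upper unfolding c_def by blast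
qed

end
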